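(* For every $2 \leqslant s \leqslant t$, there exist constants $C > 0$, $\delta > 0$ and $k_0 \in \mathbb{N}$ (and a constant $c > 0$) such that the following holds for every $k \geqslant k_0$ and every $n \in \mathbb{N}$. Given a graph $G$ with $n$ vertices and $k n^{2-1/s}$ edges, there exists a set $\mathcal{H}$ of ordered pairs $(S,T)$ with $S, T \subset V(G)$, $|S| = s$, $|T| = t$ and $G[S,T]$ a complete bipartite graph (i.e., every vertex of $S$ is adjacent to every vertex of $T$), such that: (a) $|\mathcal{H}| \geqslant c\, k^{st} n^s$, and (b) $d_{\mathcal{H}}(A,B) \leqslant D^{(|A|,|B|)}(k,n)$ for all $A, B \subset V(G)$ with $1 \leqslant |A| \leqslant s$ and $1 \leqslant |B| \leqslant t$.
   Context: For $A, B \subset V(G)$, $d_{\mathcal{H}}(A,B) = |\{(S,T) \in \mathcal{H} : A \subset S \text{ and } B \subset T\}|$. For $1 \leqslant i \leqslant s$ and $1 \leqslant j \leqslant t$, $D^{(i,j)}(k,n) = (\delta k n^{(s-1)/s})^{s-i} (\delta k^s)^{t-j}$, where $\delta$ is the constant of the statement. The paper writes (a) as $e(\mathcal{H}) = \Omega(k^{st} n^s)$, meaning at least a constant (depending only on $s,t$) times $k^{st}n^s$. *)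

theory Defs
  imports "HOL-Library.Ramsey" "HOL-Analysis.Analysis"
begin

text \<open>Finite simple graphs: \<open>E\<close> is a set of two-element subsets of the finite vertex set \<open>V\<close>.\<close>

definition simple_graph :: "'a set \<Rightarrow> 'a set set \<Rightarrow> bool" where
  "simple_graph V E \<longleftrightarrow> finite V \<and> E \<subseteq> [V]\<^bsup>2\<^esup>"

text \<open>Since edges have two elements, completeness between \<open>S\<close> and \<open>T\<close> forces
  \<open>S \<inter> T = {}\<close>. The copies are not required to be induced.\<close>

definition complete_between :: "'a set set \<Rightarrow> 'a set \<Rightarrow> 'a set \<Rightarrow> bool" where
  "complete_between E S T \<longleftrightarrow> (\<forall>x\<in>S. \<forall>y\<in>T. {x, y} \<in> E)"

definition pair_degree :: "('a set \<times> 'a set) set \<Rightarrow> 'a set \<Rightarrow> 'a set \<Rightarrow> nat" where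
  "pair_degree H A B = card {(S, T). (S, T) \<in> H \<and> A \<subseteq> S \<and> B \<subseteq> T}"

text \<open>\<open>max_degree s t \<delta> i j k n\<close> is \<open>D\<close> with superscript \<open>(i, j)\<close> at \<open>(k, n)\<close>; it is only used
  for \<open>i \<le> s\<close> and \<open>j \<le> t\<close>, where the natural subtractions are not truncated. The density
  parameter \<open>k\<close> is real.\<close>

definition max_degree :: "nat \<Rightarrow> nat \<Rightarrow> real \<Rightarrow> nat \<Rightarrow> nat \<Rightarrow> real \<Rightarrow> nat \<Rightarrow> real" where
  "max_degree s t \<delta> i j k n =
     (\<delta> * k * real n powr ((real s - 1) / real s)) ^ (s - i) * (\<delta> * k ^ s) ^ (t - j)"

end

theory Submission
  imports Defs
begin

text \<open>Take a maximal family \<open>H\<close> of copies of \<open>K\<^sub>s\<^sub>,\<^sub>t\<close> obeying the degree bounds, and call \<open>(A, B)\<close>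
  saturated if its degree cannot grow by one. Double counting shows that the degree bound at
  \<open>(A, B)\<close> leaves at most \<open>O(\<delta> k n\<^bsup>1-1/s\<^esup>)\<close> vertices whose addition to \<open>A\<close>, and at most \<open>O(\<delta> k\<^sup>s)\<close>
  whose addition to \<open>B\<close>, creates a saturated pair. If \<open>H\<close> is small, at most half of the oriented
  edges are saturated; discard these. For small \<open>\<delta>\<close> one can then pick, for every vertex \<open>y\<close> of large
  degree, a positive proportion of the \<open>s\<close>-tuples in its neighbourhood without creating a saturated
  pair \<open>(A, {y})\<close>. By averaging over the \<open>n\<^sup>s\<close> tuples, some \<open>S\<close> is picked for at least
  \<open>(k/4)\<^sup>s\<close> vertices \<open>y\<close>, and \<open>T\<close> can be chosen greedily among those. The new pair \<open>(S, T)\<close>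
  contradicts the maximality of \<open>H\<close>.\<close>

section \<open>Double counting and counting lists\<close>

text \<open>Both sides bound the number of incident pairs \<open>(x, p)\<close>: points of
  \<open>Y\<close> alone contribute at least \<open>\<theta>\<close> each, and every
  \<open>p\<close> contributes at most \<open>q\<close>. All three counts of saturated pairs below
  are instances, with \<open>K\<close> a set of members of the family.\<close>

lemma card_heavy_points:
  fixes \<theta> :: real
  assumes "finite X" and "finite K"
    and "\<And>p. p \<in> K \<Longrightarrow> card {x \<in> X. r x p} \<le> q"
    and "\<And>x. x \<in> Y \<Longrightarrow> \<theta> \<le> real (card {p \<in> K. r x p})"
    and "Y \<subseteq> X"
  shows "real (card Y) * \<theta> \<le> real q * real (card K)"
proof -
  have "real (card Y) * \<theta> = (\<Sum>x\<in>Y. \<theta>)" by simp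
  also have "\<dots> \<le> (\<Sum>x\<in>Y. real (card {p \<in> K. r x p}))"
    using assms(4) by (rule sum_mono)
  also have "\<dots> \<le> (\<Sum>x\<in>X. real (card {p \<in> K. r x p}))"
    using assms(1,5) by (intro sum_mono2) auto
  also have "\<dots> = real (\<Sum>x\<in>X. card {p \<in> K. r x p})" by simp
  also have "(\<Sum>x\<in>X. card {p \<in> K. r x p}) = (\<Sum>p\<in>K. card {x \<in> X. r x p})"
    using assms(1,2) by (rule sum_multicount_gen) simp
  also have "real \<dots> \<le> real (q * card K)"
    using sum_bounded_above[of K "\<lambda>p. card {x \<in> X. r x p}" q] assms(3)
    by (simp only: of_nat_le_iff) (simp add: mult.commute)
  finally show ?thesis by simp
qed

text \<open>Each admissible list shorter than \<open>l\<close> has at least \<open>r\<close>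
  admissible extensions, and \<open>x # xs\<close> determines both \<open>x\<close> and
  \<open>xs\<close>, so the count grows by a factor of at least \<open>r\<close> with every new
  head.\<close>

lemma card_lists_ge_power:
  fixes r :: real
  assumes "finite X" and "0 \<le> r" and "P []"
    and subset: "\<And>xs. P xs \<Longrightarrow> set xs \<subseteq> X"
    and step: "\<And>xs. P xs \<Longrightarrow> length xs < l \<Longrightarrow> r \<le> real (card {x \<in> X. P (x # xs)})"
    and "i \<le> l"
  shows "r ^ i \<le> real (card {xs. length xs = i \<and> P xs})"
  using \<open>i \<le> l\<close>
proof (induction i)
  case 0
  have "{xs. length xs = 0 \<and> P xs} = {[]}" using assms(3) by auto
  then show ?case by simp
next
  case (Suc i)
  let ?L = "\<lambda>i. {xs. length xs = i \<and> P xs}"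
  let ?Q = "SIGMA xs : ?L i. {x \<in> X. P (x # xs)}"
  have fin: "finite (?L j)" for j
    by (rule finite_subset[OF _ finite_lists_length_eq[OF assms(1), of j]]) (use subset in auto)
  have "r ^ Suc i \<le> r * real (card (?L i))"
    using Suc assms(2) by (simp add: mult_left_mono)
  also have "\<dots> = (\<Sum>xs\<in>?L i. r)" by simp
  also have "\<dots> \<le> (\<Sum>xs\<in>?L i. real (card {x \<in> X. P (x # xs)}))"
    by (rule sum_mono) (use step Suc.prems in auto)
  also have "\<dots> = real (card ?Q)"
    using fin assms(1) by simp
  also have "card ?Q = card ((\<lambda>(xs, x). x # xs) ` ?Q)"
    by (rule card_image[symmetric]) (auto simp: inj_on_def)
  also have "real \<dots> \<le> real (card (?L (Suc i)))"
    unfolding of_nat_le_iff by (rule card_mono[OF fin]) auto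
  finally show ?case .
qed

section \<open>Saturated pairs in a family with bounded degrees\<close>

text \<open>\<open>p\<close> and \<open>q\<close> bound the factor by which the permitted degree drops when one vertex is added
  on the left or on the right.\<close>

locale bounded_degree_family =
  fixes s t :: nat and V :: "'a set" and H :: "('a set \<times> 'a set) set"
    and D :: "nat \<Rightarrow> nat \<Rightarrow> real" and p q :: real
  assumes finite_V: "finite V"
    and members: "(S, T) \<in> H \<Longrightarrow> S \<subseteq> V \<and> T \<subseteq> V \<and> card S = s \<and> card T = t"
    and degree_le: "\<lbrakk>A \<subseteq> V; B \<subseteq> V; 1 \<le> card A; card A \<le> s; 1 \<le> card B; card B \<le> t\<rbrakk>
      \<Longrightarrow> real (pair_degree H A B) \<le> D (card A) (card B)"
    and D_cases: "\<lbrakk>1 \<le> i; i \<le> s; 1 \<le> j; j \<le> t\<rbrakk> \<Longrightarrow> D i j = 1 \<or> 2 \<le> D i j"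
    and D_left: "\<lbrakk>1 \<le> i; i < s; 1 \<le> j; j \<le> t\<rbrakk> \<Longrightarrow> D i j \<le> p * D (Suc i) j"
    and D_right: "\<lbrakk>1 \<le> i; i \<le> s; 1 \<le> j; j < t\<rbrakk> \<Longrightarrow> D i j \<le> q * D i (Suc j)"
    and p_nonneg: "0 \<le> p" and q_nonneg: "0 \<le> q"
begin

text \<open>An inequality rather than an equation, since \<open>D\<close> is real-valued and a
  degree need not attain it exactly.\<close>

definition saturated :: "'a set \<Rightarrow> 'a set \<Rightarrow> bool" where
  "saturated A B \<longleftrightarrow> D (card A) (card B) < real (pair_degree H A B) + 1"

lemma finite_H: "finite H"
proof (rule finite_subset)
  show "H \<subseteq> Pow V \<times> Pow V" by (auto dest: members[THEN conjunct1] members[THEN conjunct2, THEN conjunct1])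
qed (use finite_V in simp)

text \<open>If the bound is 1, integrality gives degree at least 1. If it is at least 2, the degree
  exceeds the bound minus 1, hence half the bound.\<close>

lemma saturated_degree_ge:
  assumes "saturated A B" "1 \<le> card A" "card A \<le> s" "1 \<le> card B" "card B \<le> t"
  shows "D (card A) (card B) / 2 \<le> real (pair_degree H A B)"
  using D_cases[OF assms(2-5)]
proof
  assume D: "D (card A) (card B) = 1"
  then have "0 < pair_degree H A B" using assms(1) by (simp add: saturated_def)
  then show ?thesis using D by simp
qed (use assms(1) in \<open>simp add: saturated_def\<close>)

lemma D_pos: "\<lbrakk>1 \<le> i; i \<le> s; 1 \<le> j; j \<le> t\<rbrakk> \<Longrightarrow> 0 < D i j"
  using D_cases by fastforce

text \<open>At most \<open>D (card A) (card B)\<close> members lie above \<open>(A, B)\<close>.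
  Every saturating \<open>x\<close> belongs to at least half of
  \<open>D (Suc (card A)) (card B)\<close> of them, and each member has only \<open>s\<close> left
  vertices. By \<open>D_left\<close> the quotient of the two bounds is at most
  \<open>p\<close>.\<close>

lemma card_saturated_left:
  assumes "A \<subseteq> V" "B \<subseteq> V" "1 \<le> card A" "card A < s" "1 \<le> card B" "card B \<le> t"
  shows "real (card {x \<in> V - A. saturated (insert x A) B}) \<le> 2 * real s * p"
proof -
  let ?Y = "{x \<in> V - A. saturated (insert x A) B}"
  let ?K = "{(S, T). (S, T) \<in> H \<and> A \<subseteq> S \<and> B \<subseteq> T}"
  let ?D = "D (Suc (card A)) (card B)"
  have finA: "finite A" using assms(1) finite_V finite_subset by blast
  have "real (card ?Y) * (?D / 2) \<le> real s * real (card ?K)"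
  proof (rule card_heavy_points[where X = V and r = "\<lambda>x P. x \<in> fst P"])
    show "finite ?K" by (rule finite_subset[OF _ finite_H]) auto
    fix P assume "P \<in> ?K"
    then have "fst P \<subseteq> V" "card (fst P) = s" using members[of "fst P" "snd P"] by auto
    then show "card {x \<in> V. x \<in> fst P} \<le> s"
      by (metis (no_types, lifting) Collect_mem_eq Collect_mono_iff card_mono finite_V finite_subset mem_Collect_eq)
  next
    fix x assume x: "x \<in> ?Y"
    have eq: "{P \<in> ?K. x \<in> fst P} = {(S, T). (S, T) \<in> H \<and> insert x A \<subseteq> S \<and> B \<subseteq> T}" by auto
    show "?D / 2 \<le> real (card {P \<in> ?K. x \<in> fst P})"
      using saturated_degree_ge[of "insert x A" B] x finA assms
      unfolding eq pair_degree_def[symmetric] by simp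
  qed (use finite_V in auto)
  also have "\<dots> \<le> real s * D (card A) (card B)"
    using degree_le[of A B] assms by (intro mult_left_mono) (auto simp: pair_degree_def)
  also have "\<dots> \<le> real s * (p * ?D)"
    using D_left assms by (intro mult_left_mono) auto
  finally have "real (card ?Y) * ?D \<le> (2 * real s * p) * ?D" by simp
  then show ?thesis using D_pos[of "Suc (card A)" "card B"] assms by simp
qed

text \<open>The mirror image of \<open>card_saturated_left\<close>: a member has \<open>t\<close>
  right vertices, and \<open>D_right\<close> supplies the quotient \<open>q\<close>.\<close>

lemma card_saturated_right:
  assumes "A \<subseteq> V" "B \<subseteq> V" "1 \<le> card A" "card A \<le> s" "1 \<le> card B" "card B < t"
  shows "real (card {y \<in> V - B. saturated A (insert y B)}) \<le> 2 * real t * q"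
proof -
  let ?Y = "{y \<in> V - B. saturated A (insert y B)}"
  let ?K = "{(S, T). (S, T) \<in> H \<and> A \<subseteq> S \<and> B \<subseteq> T}"
  let ?D = "D (card A) (Suc (card B))"
  have finB: "finite B" using assms(2) finite_V finite_subset by blast
  have "real (card ?Y) * (?D / 2) \<le> real t * real (card ?K)"
  proof (rule card_heavy_points[where X = V and r = "\<lambda>x P. x \<in> snd P"])
    show "finite ?K" by (rule finite_subset[OF _ finite_H]) auto
    fix P assume "P \<in> ?K"
    then have "snd P \<subseteq> V" "card (snd P) = t" using members[of "fst P" "snd P"] by auto
    then show "card {x \<in> V. x \<in> snd P} \<le> t"
      by (metis (no_types, lifting) Collect_mem_eq Collect_mono_iff card_mono finite_V finite_subset mem_Collect_eq)
  next
    fix y assume y: "y \<in> ?Y"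
    have eq: "{P \<in> ?K. y \<in> snd P} = {(S, T). (S, T) \<in> H \<and> A \<subseteq> S \<and> insert y B \<subseteq> T}" by auto
    show "?D / 2 \<le> real (card {P \<in> ?K. y \<in> snd P})"
      using saturated_degree_ge[of A "insert y B"] y finB assms
      unfolding eq pair_degree_def[symmetric] by simp
  qed (use finite_V in auto)
  also have "\<dots> \<le> real t * D (card A) (card B)"
    using degree_le[of A B] assms by (intro mult_left_mono) (auto simp: pair_degree_def)
  also have "\<dots> \<le> real t * (q * ?D)"
    using D_right assms by (intro mult_left_mono) auto
  finally have "real (card ?Y) * ?D \<le> (2 * real t * q) * ?D" by simp
  then show ?thesis using D_pos[of "card A" "Suc (card B)"] assms by simp
qed

text \<open>The same count over the whole family: a member covers \<open>s * t\<close> ordered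
  pairs, and a saturated pair is covered at least \<open>D 1 1 / 2\<close> times. Thus a small
  family saturates few edges.\<close>

lemma card_saturated_edges:
  assumes "1 \<le> s" "1 \<le> t"
  shows "real (card {(x, y) \<in> V \<times> V. saturated {x} {y}}) * D 1 1
    \<le> 2 * real s * real t * real (card H)"
proof -
  let ?Y = "{(x, y) \<in> V \<times> V. saturated {x} {y}}"
  have "real (card ?Y) * (D 1 1 / 2) \<le> real (s * t) * real (card H)"
  proof (rule card_heavy_points[where X = "V \<times> V" and r = "\<lambda>e P. e \<in> fst P \<times> snd P"])
    fix P assume "P \<in> H"
    then have P: "fst P \<subseteq> V" "card (fst P) = s" "snd P \<subseteq> V" "card (snd P) = t"
      using members[of "fst P" "snd P"] by auto
    then have "{e \<in> V \<times> V. e \<in> fst P \<times> snd P} = fst P \<times> snd P" by auto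
    then show "card {e \<in> V \<times> V. e \<in> fst P \<times> snd P} \<le> s * t"
      using P by (simp add: card_cartesian_product)
  next
    fix e assume e: "e \<in> ?Y"
    obtain x y where xy: "e = (x, y)" by force
    have eq: "{P \<in> H. e \<in> fst P \<times> snd P} = {(S, T). (S, T) \<in> H \<and> {x} \<subseteq> S \<and> {y} \<subseteq> T}"
      using xy by auto
    show "D 1 1 / 2 \<le> real (card {P \<in> H. e \<in> fst P \<times> snd P})"
      using saturated_degree_ge[of "{x}" "{y}"] e xy assms
      unfolding eq pair_degree_def[symmetric] by simp
  qed (use finite_V finite_H in auto)
  then show ?thesis by simp
qed

section \<open>Greedy choices that avoid saturated pairs\<close>

text \<open>The left side is kept as a list so that greedy choices multiply to a plain power
  \<open>r ^ s\<close>, to be compared with the \<open>card V ^ s\<close> lists over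
  \<open>V\<close>. \<open>R\<close> is meant as the neighbourhood of \<open>y\<close>.\<close>

definition good_list :: "'a set \<Rightarrow> 'a \<Rightarrow> 'a list \<Rightarrow> bool" where
  "good_list R y xs \<longleftrightarrow> distinct xs \<and> set xs \<subseteq> R
    \<and> (\<forall>A. A \<subseteq> set xs \<longrightarrow> A \<noteq> {} \<longrightarrow> \<not> saturated A {y})"

text \<open>A vertex \<open>x\<close> of \<open>R\<close> fails to extend \<open>xs\<close> only if
  it repeats an entry or if \<open>insert x A\<close> is saturated with \<open>{y}\<close> for some
  nonempty \<open>A\<close> within \<open>xs\<close>; the set \<open>{x}\<close> itself is covered
  by \<open>unsaturated\<close>. Fewer than \<open>2 ^ s\<close> sets \<open>A\<close> occur, each
  excluding at most \<open>2 * s * p\<close> vertices, so \<open>r\<close> choices remain.\<close>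

lemma card_good_lists_ge:
  assumes "R \<subseteq> V" "y \<in> V" "1 \<le> t" "0 \<le> r"
    and unsaturated: "\<And>x. x \<in> R \<Longrightarrow> \<not> saturated {x} {y}"
    and large: "r + real s + 2 ^ s * (2 * real s * p) \<le> real (card R)"
  shows "r ^ s \<le> real (card {xs. length xs = s \<and> good_list R y xs})"
proof (rule card_lists_ge_power[of R _ _ s])
  show "finite R" using assms(1) finite_V finite_subset by blast
  show "good_list R y []" by (simp add: good_list_def)
  show "set xs \<subseteq> R" if "good_list R y xs" for xs using that by (simp add: good_list_def)
  fix xs assume xs: "good_list R y xs" and len: "length xs < s"
  let ?bad = "\<lambda>A. {x \<in> V - A. saturated (insert x A) {y}}"
  let ?\<A> = "Pow (set xs) - {{}}"
  let ?ext = "{x \<in> R. good_list R y (x # xs)}"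
  have "R \<subseteq> ?ext \<union> set xs \<union> (\<Union>A\<in>?\<A>. ?bad A)"
  proof
    fix x assume x: "x \<in> R"
    have "good_list R y (x # xs)" if x': "x \<notin> set xs" and ok: "\<forall>A\<in>?\<A>. x \<notin> ?bad A"
      unfolding good_list_def
    proof (intro conjI allI impI)
      fix A assume A: "A \<subseteq> set (x # xs)" "A \<noteq> {}"
      show "\<not> saturated A {y}"
      proof (cases "x \<in> A")
        case True
        show ?thesis
        proof (cases "A = {x}")
          case False
          then have "A - {x} \<in> ?\<A>" using A True by auto
          then have "x \<notin> ?bad (A - {x})" using ok by blast
          then show ?thesis using x assms(1) True by (auto simp: insert_absorb)
        qed (use unsaturated x in simp)
      next
        case False
        then show ?thesis using xs A by (auto simp: good_list_def)
      qed
    qed (use xs x x' in \<open>auto simp: good_list_def\<close>)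
    then show "x \<in> ?ext \<union> set xs \<union> (\<Union>A\<in>?\<A>. ?bad A)" using x by blast
  qed
  then have "card R \<le> card (?ext \<union> set xs \<union> (\<Union>A\<in>?\<A>. ?bad A))"
    by (rule card_mono[rotated]) (use \<open>finite R\<close> finite_V in auto)
  also have "\<dots> \<le> card (?ext \<union> set xs) + card (\<Union>A\<in>?\<A>. ?bad A)" by (rule card_Un_le)
  also have "\<dots> \<le> card ?ext + card (set xs) + card (\<Union>A\<in>?\<A>. ?bad A)"
    by (simp add: card_Un_le)
  also have "\<dots> \<le> card ?ext + card (set xs) + (\<Sum>A\<in>?\<A>. card (?bad A))"
    by (intro add_left_mono card_UN_le) simp
  finally have "real (card R) \<le> real (card ?ext) + real (card (set xs)) + (\<Sum>A\<in>?\<A>. real (card (?bad A)))"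
    by (simp flip: of_nat_sum of_nat_add)
  moreover have "real (card (set xs)) \<le> real s"
    using card_length[of xs] len by simp
  moreover have "(\<Sum>A\<in>?\<A>. real (card (?bad A))) \<le> (\<Sum>A\<in>?\<A>. 2 * real s * p)"
  proof (rule sum_mono)
    fix A assume A: "A \<in> ?\<A>"
    then have "finite A" "A \<noteq> {}" "card A \<le> card (set xs)"
      by (auto dest: finite_subset intro: card_mono)
    \<comment> \<open>Since \<open>xs\<close> is not yet full, \<open>A\<close> leaves room for one
      more vertex, as \<open>card_saturated_left\<close> demands.\<close>
    then have "1 \<le> card A" "card A < s"
      using card_length[of xs] len by (auto simp: Suc_le_eq card_gt_0_iff)
    moreover have "A \<subseteq> V" using A xs assms(1) by (auto simp: good_list_def)
    ultimately show "real (card (?bad A)) \<le> 2 * real s * p"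
      using card_saturated_left[of A "{y}"] assms(2,3) by simp
  qed
  moreover have "(\<Sum>A\<in>?\<A>. 2 * real s * p) \<le> 2 ^ s * (2 * real s * p)"
  proof -
    have "card ?\<A> \<le> card (Pow (set xs))" by (rule card_mono) auto
    also have "\<dots> = 2 ^ card (set xs)" by (simp add: card_Pow)
    also have "\<dots> \<le> 2 ^ s" using card_length[of xs] len by (intro power_increasing) auto
    finally have "real (card ?\<A>) \<le> 2 ^ s" by (simp flip: of_nat_le_iff)
    then have "real (card ?\<A>) * (2 * real s * p) \<le> 2 ^ s * (2 * real s * p)"
      using p_nonneg by (intro mult_right_mono) auto
    then show ?thesis by simp
  qed
  ultimately show "r \<le> real (card ?ext)" using large by linarith
qed (use assms in auto)

text \<open>\<open>T\<close> grows one vertex at a time. A new \<open>y\<close> must avoid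
  \<open>T\<close> and the vertices saturating some \<open>(A, insert y B)\<close> with nonempty
  \<open>A\<close> in \<open>S\<close> and \<open>B\<close> in \<open>T\<close>; the case
  \<open>B = {}\<close> is the hypothesis \<open>unsaturated\<close>. Since \<open>large\<close>
  exceeds the total number excluded, a choice always remains.\<close>

lemma exists_unsaturated_right:
  assumes "S \<subseteq> V" "card S = s" "Y \<subseteq> V"
    and unsaturated: "\<And>A y. \<lbrakk>A \<subseteq> S; A \<noteq> {}; y \<in> Y\<rbrakk> \<Longrightarrow> \<not> saturated A {y}"
    and large: "real t + 2 ^ (s + t) * (2 * real t * q) < real (card Y)"
  shows "\<exists>T \<subseteq> Y. card T = t \<and>
    (\<forall>A B. A \<subseteq> S \<longrightarrow> A \<noteq> {} \<longrightarrow> B \<subseteq> T \<longrightarrow> B \<noteq> {} \<longrightarrow> \<not> saturated A B)"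
proof -
  have finS: "finite S" and finY: "finite Y" using assms(1,3) finite_V finite_subset by blast+
  have "\<exists>T \<subseteq> Y. card T = j \<and>
    (\<forall>A B. A \<subseteq> S \<longrightarrow> A \<noteq> {} \<longrightarrow> B \<subseteq> T \<longrightarrow> B \<noteq> {} \<longrightarrow> \<not> saturated A B)" if "j \<le> t" for j
    using that
  proof (induction j)
    case 0
    show ?case by (intro exI[of _ "{}"]) auto
  next
    case (Suc j)
    then obtain T where T: "T \<subseteq> Y" "card T = j"
      and unsat: "\<And>A B. \<lbrakk>A \<subseteq> S; A \<noteq> {}; B \<subseteq> T; B \<noteq> {}\<rbrakk> \<Longrightarrow> \<not> saturated A B"
      by auto
    have finT: "finite T" using T finY finite_subset by blast
    let ?bad = "\<lambda>(A, B). {y \<in> V - B. saturated A (insert y B)}"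
    let ?\<A> = "(Pow S - {{}}) \<times> (Pow T - {{}})"
    have "card (T \<union> (\<Union>P\<in>?\<A>. ?bad P)) \<le> card T + card (\<Union>P\<in>?\<A>. ?bad P)" by (rule card_Un_le)
    also have "\<dots> \<le> card T + (\<Sum>P\<in>?\<A>. card (?bad P))"
      by (intro add_left_mono card_UN_le) (use finS finT in simp)
    finally have "real (card (T \<union> (\<Union>P\<in>?\<A>. ?bad P))) \<le> real (card T) + (\<Sum>P\<in>?\<A>. real (card (?bad P)))"
      by (simp flip: of_nat_sum of_nat_add)
    also have "(\<Sum>P\<in>?\<A>. real (card (?bad P))) \<le> (\<Sum>P\<in>?\<A>. 2 * real t * q)"
    proof (rule sum_mono)
      fix P assume "P \<in> ?\<A>"
      then obtain A B where P: "P = (A, B)" and AB: "A \<subseteq> S" "A \<noteq> {}" "B \<subseteq> T" "B \<noteq> {}"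
        by blast
      have "1 \<le> card A" "1 \<le> card B"
        using AB finS finT finite_subset by (metis One_nat_def Suc_leI card_gt_0_iff)+
      \<comment> \<open>Here \<open>card T = j < t\<close>, so the right-hand count applies to every
        \<open>B\<close> within \<open>T\<close>.\<close>
      moreover have "card A \<le> s" "card B < t"
        using card_mono[OF finS AB(1)] card_mono[OF finT AB(3)] assms(2) T(2) Suc.prems by auto
      moreover have "A \<subseteq> V" "B \<subseteq> V" using AB T assms(1,3) by auto
      ultimately show "real (card (?bad P)) \<le> 2 * real t * q"
        using card_saturated_right[of A B] P by simp
    qed
    also have "(\<Sum>P\<in>?\<A>. 2 * real t * q) \<le> 2 ^ (s + t) * (2 * real t * q)"
    proof -
      have "card ?\<A> \<le> card (Pow S \<times> Pow T)" by (rule card_mono) (use finS finT in auto)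
      also have "\<dots> = 2 ^ (s + j)"
        using finS finT T(2) assms(2) by (simp add: card_cartesian_product card_Pow power_add)
      also have "\<dots> \<le> 2 ^ (s + t)" using Suc.prems by (intro power_increasing) auto
      finally have "real (card ?\<A>) \<le> 2 ^ (s + t)" by (simp flip: of_nat_le_iff)
      then have "real (card ?\<A>) * (2 * real t * q) \<le> 2 ^ (s + t) * (2 * real t * q)"
        using q_nonneg by (intro mult_right_mono) auto
      then show ?thesis by simp
    qed
    finally have "card (T \<union> (\<Union>P\<in>?\<A>. ?bad P)) < card Y" using large T(2) Suc.prems by simp
    moreover have "finite (T \<union> (\<Union>P\<in>?\<A>. ?bad P))" using finS finT finite_V by auto
    ultimately have "\<not> Y \<subseteq> T \<union> (\<Union>P\<in>?\<A>. ?bad P)" by (meson card_mono leD)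
    then obtain y where "y \<in> Y" and notin: "y \<notin> T \<union> (\<Union>P\<in>?\<A>. ?bad P)"
      by (meson subsetI)
    have y: "y \<in> Y" "y \<notin> T" using \<open>y \<in> Y\<close> notin by simp_all
    have ok: "y \<notin> ?bad (A, B)" if "A \<subseteq> S" "A \<noteq> {}" "B \<subseteq> T" "B \<noteq> {}" for A B
    proof
      assume "y \<in> ?bad (A, B)"
      then have "y \<in> T \<union> (\<Union>P\<in>?\<A>. ?bad P)" by (intro UnI2 UN_I[of "(A, B)"]) (use that in simp_all)
      then show False using notin by simp
    qed
    show ?case
    proof (intro exI[of _ "insert y T"] conjI allI impI)
      fix A B assume AB: "A \<subseteq> S" "A \<noteq> {}" "B \<subseteq> insert y T" "B \<noteq> {}"
      show "\<not> saturated A B"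
      proof (cases "y \<in> B")
        case True
        show ?thesis
        proof (cases "B = {y}")
          case False
          then have "B - {y} \<subseteq> T" "B - {y} \<noteq> {}" using AB True by auto
          then have "y \<notin> ?bad (A, B - {y})" using ok AB by blast
          then show ?thesis using y assms(3) True by (auto simp: insert_absorb)
        qed (use unsaturated AB y in simp)
      qed (use unsat AB in blast)
    qed (use y T finT in auto)
  qed
  then show ?thesis by blast
qed

section \<open>Averaging over tuples\<close>

text \<open>Many good lists exist for each \<open>y\<close> of large degree, so some list is good
  for many \<open>y\<close> at once. Its entries form \<open>S\<close>, and \<open>T\<close> is then
  chosen among those \<open>y\<close>.\<close>

lemma exists_unsaturated_pair:
  assumes "F \<subseteq> V \<times> V" "1 \<le> s" "1 \<le> t" "0 \<le> m"
    and unsaturated: "\<And>x y. (x, y) \<in> F \<Longrightarrow> \<not> saturated {x} {y}"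
    and dense: "real (card V) * m \<le> real (card F)"
    and m_large: "8 * real s \<le> m" "8 * (2 ^ s * (2 * real s * p)) \<le> m"
    and many: "real (card V) ^ s * (real t + 2 ^ (s + t) * (2 * real t * q)) < real (card V) * (m / 4) ^ s"
  shows "\<exists>S T. S \<subseteq> V \<and> T \<subseteq> V \<and> card S = s \<and> card T = t \<and> S \<times> T \<subseteq> F \<and>
    (\<forall>A B. A \<subseteq> S \<longrightarrow> A \<noteq> {} \<longrightarrow> B \<subseteq> T \<longrightarrow> B \<noteq> {} \<longrightarrow> \<not> saturated A B)"
proof -
  define R where "R y = {x. (x, y) \<in> F}" for y
  define d where "d y = real (card (R y))" for y
  define L where "L = {xs. set xs \<subseteq> V \<and> length xs = s}"
  define N where "N xs = {y \<in> V. good_list (R y) y xs}" for xs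
  \<comment> \<open>Vertices of degree below \<open>m / 2\<close> carry at most half of the
    \<open>card V * m\<close> pairs guaranteed by \<open>dense\<close>, so \<open>W\<close> keeps
    the other half.\<close>
  define W where "W = {y \<in> V. m / 2 \<le> d y}"
  have R: "R y \<subseteq> V" "finite (R y)" for y
    using assms(1) finite_V finite_subset[of "R y" V] by (auto simp: R_def)
  have finL: "finite L" and cardL: "card L = card V ^ s"
    using finite_lists_length_eq[OF finite_V] card_lists_length_eq[OF finite_V] by (auto simp: L_def)
  have finW: "finite W" "W \<subseteq> V" using finite_V by (auto simp: W_def)
  have "card F = card (SIGMA y:V. R y)"
    by (rule bij_betw_same_card[OF bij_betwI[of prod.swap _ _ prod.swap]])
       (use assms(1) in \<open>auto simp: R_def\<close>)
  then have "real (card F) = (\<Sum>y\<in>V. d y)"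
    using R finite_V by (simp add: d_def)
  also have "\<dots> = (\<Sum>y\<in>W. d y) + (\<Sum>y\<in>V - W. d y)"
    by (subst add.commute, rule sum.subset_diff) (use finite_V finW in auto)
  also have "(\<Sum>y\<in>V - W. d y) \<le> (\<Sum>y\<in>V - W. m / 2)" by (rule sum_mono) (auto simp: W_def)
  also have "\<dots> \<le> (\<Sum>y\<in>V. m / 2)" using finite_V assms(4) by (intro sum_mono2) auto
  finally have heavy: "real (card V) * (m / 2) \<le> (\<Sum>y\<in>W. d y)" using dense by (simp add: field_simps)
  obtain s' where s': "s = Suc s'" using assms(2) by (cases s) auto
  \<comment> \<open>In place of convexity, one factor \<open>d y / 2\<close> is summed while the
    other \<open>s - 1\<close> factors are bounded below by \<open>m / 4\<close>.\<close>
  have "real (card V) * (m / 4) ^ s = (real (card V) * (m / 2)) / 2 * (m / 4) ^ s'"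
    by (simp add: s')
  also have "\<dots> \<le> (\<Sum>y\<in>W. d y) / 2 * (m / 4) ^ s'"
    using heavy assms(4) by (intro mult_right_mono divide_right_mono) auto
  also have "\<dots> = (\<Sum>y\<in>W. d y / 2 * (m / 4) ^ s')"
    by (simp add: sum_distrib_right sum_divide_distrib)
  also have "\<dots> \<le> (\<Sum>y\<in>W. (d y / 2) ^ s)"
  proof (rule sum_mono)
    fix y assume "y \<in> W"
    then have "(m / 4) ^ s' \<le> (d y / 2) ^ s'" using assms(4) by (intro power_mono) (auto simp: W_def)
    then show "d y / 2 * (m / 4) ^ s' \<le> (d y / 2) ^ s"
      unfolding s' power_Suc by (rule mult_left_mono) (simp add: d_def)
  qed
  also have "\<dots> \<le> (\<Sum>y\<in>W. real (card {xs. length xs = s \<and> good_list (R y) y xs}))"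
  proof (rule sum_mono)
    fix y assume y: "y \<in> W"
    \<comment> \<open>By \<open>m_large\<close> both error terms are at most \<open>m / 8\<close>,
      together at most \<open>m / 4\<close>, which is at most \<open>d y / 2\<close> on
      \<open>W\<close>.\<close>
    then have "d y / 2 + real s + 2 ^ s * (2 * real s * p) \<le> real (card (R y))"
      using m_large by (simp add: W_def d_def)
    then show "(d y / 2) ^ s \<le> real (card {xs. length xs = s \<and> good_list (R y) y xs})"
      using y R assms(3) unsaturated by (intro card_good_lists_ge) (auto simp: W_def d_def R_def)
  qed
  also have "\<dots> \<le> (\<Sum>y\<in>V. real (card {xs. length xs = s \<and> good_list (R y) y xs}))"
    using finite_V finW by (intro sum_mono2) auto
  also have "\<dots> = (\<Sum>y\<in>V. real (card {xs \<in> L. good_list (R y) y xs}))"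
  proof (rule sum.cong[OF refl])
    fix y
    have "{xs. length xs = s \<and> good_list (R y) y xs} = {xs \<in> L. good_list (R y) y xs}"
      using R(1)[of y] by (auto simp: L_def good_list_def)
    then show "real (card {xs. length xs = s \<and> good_list (R y) y xs}) =
      real (card {xs \<in> L. good_list (R y) y xs})" by simp
  qed
  also have "\<dots> = real (\<Sum>y\<in>V. card {xs \<in> L. good_list (R y) y xs})" by simp
  also have "(\<Sum>y\<in>V. card {xs \<in> L. good_list (R y) y xs}) = (\<Sum>xs\<in>L. card (N xs))"
    unfolding N_def using finite_V finL by (rule sum_multicount_gen) simp
  finally have total: "real (card V) * (m / 4) ^ s \<le> (\<Sum>xs\<in>L. real (card (N xs)))" by simp
  \<comment> \<open>Pigeonhole: \<open>L\<close> has exactly \<open>card V ^ s\<close> lists, so by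
    \<open>many\<close> they cannot all have small \<open>N xs\<close>.\<close>
  have "\<exists>xs\<in>L. real t + 2 ^ (s + t) * (2 * real t * q) < real (card (N xs))"
  proof (rule ccontr)
    assume "\<not> ?thesis"
    then have "(\<Sum>xs\<in>L. real (card (N xs))) \<le> (\<Sum>xs\<in>L. real t + 2 ^ (s + t) * (2 * real t * q))"
      by (intro sum_mono) (auto simp: not_less)
    then show False using total many cardL by simp
  qed
  then obtain xs where xs: "xs \<in> L" and N: "real t + 2 ^ (s + t) * (2 * real t * q) < real (card (N xs))"
    by blast
  have "0 \<le> 2 ^ (s + t) * (2 * real t * q)" using q_nonneg by simp
  then have "card (N xs) \<noteq> 0" using N by linarith
  \<comment> \<open>Some \<open>y\<close> witnesses that \<open>xs\<close> is good, hence distinct,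
    so \<open>set xs\<close> really has \<open>s\<close> elements.\<close>
  then have "N xs \<noteq> {}" by auto
  then have dist: "distinct xs" by (auto simp: N_def good_list_def)
  have "\<exists>T \<subseteq> N xs. card T = t \<and>
    (\<forall>A B. A \<subseteq> set xs \<longrightarrow> A \<noteq> {} \<longrightarrow> B \<subseteq> T \<longrightarrow> B \<noteq> {} \<longrightarrow> \<not> saturated A B)"
    using xs dist N
    by (intro exists_unsaturated_right) (auto simp: L_def distinct_card N_def good_list_def)
  then obtain T where T: "T \<subseteq> N xs" "card T = t"
    "\<forall>A B. A \<subseteq> set xs \<longrightarrow> A \<noteq> {} \<longrightarrow> B \<subseteq> T \<longrightarrow> B \<noteq> {} \<longrightarrow> \<not> saturated A B" by blast
  show ?thesis
  proof (rule exI[of _ "set xs"], rule exI[of _ T], intro conjI)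
    show "set xs \<times> T \<subseteq> F" using T(1) by (auto simp: N_def good_list_def R_def)
  qed (use T xs dist in \<open>auto simp: L_def N_def distinct_card\<close>)
qed

end

section \<open>From the graph to a maximal family\<close>

lemma card_oriented_edges:
  assumes "simple_graph V E"
  shows "card {(x, y). {x, y} \<in> E} = 2 * card E"
proof -
  let ?O = "{(x, y). {x, y} \<in> E}"
  have finV: "finite V" and E: "\<And>e. e \<in> E \<Longrightarrow> e \<subseteq> V \<and> card e = 2"
    using assms by (auto simp: simple_graph_def nsets_def)
  have finE: "finite E" by (rule finite_subset[of _ "Pow V"]) (use E finV in auto)
  have finO: "finite ?O" by (rule finite_subset[of _ "V \<times> V"]) (use E finV in auto)
  have two: "card {z \<in> ?O. {fst z, snd z} = e} = 2" if e_in: "e \<in> E" for e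
  proof -
    obtain a b where e: "e = {a, b}" "a \<noteq> b" using conjunct2[OF E[OF e_in]] by (auto simp: card_2_iff)
    have "{z \<in> ?O. {fst z, snd z} = e} = {(a, b), (b, a)}"
      using e_in e by (auto simp: doubleton_eq_iff insert_commute)
    then show ?thesis using e by simp
  qed
  have one: "{e \<in> E. {fst z, snd z} = e} = {{fst z, snd z}}" if "z \<in> ?O" for z
    using that by auto
  have "(\<Sum>z\<in>?O. card {e \<in> E. {fst z, snd z} = e}) = (\<Sum>e\<in>E. 2)"
    using finO finE by (rule sum_multicount_gen) (use two in simp)
  moreover have "(\<Sum>z\<in>?O. card {e \<in> E. {fst z, snd z} = e}) = card ?O"
    using one by simp
  ultimately show ?thesis by simp
qed

text \<open>This is the result with explicit constants. The smallness of \<open>\<delta>\<close>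
  keeps the excluded vertices few, and \<open>2 \<le> \<delta> * k\<close> makes every degree bound
  either 1 or at least 2.\<close>

lemma balanced_family_exists:
  fixes k \<delta> :: real and V :: "'a set"
  assumes "2 \<le> s" "s \<le> t" and graph: "simple_graph V E"
    and edges: "real (card E) = k * real (card V) powr (2 - 1 / real s)"
    and \<delta>: "0 < \<delta>" "\<delta> * (2 ^ (s + t + 4) * real t * 4 ^ s) \<le> 1"
    and k: "2 \<le> \<delta> * k"
  shows "\<exists>H :: ('a set \<times> 'a set) set.
        (\<forall>(S, T)\<in>H. S \<subseteq> V \<and> T \<subseteq> V \<and> card S = s \<and> card T = t \<and> complete_between E S T) \<and>
        real (card H) \<ge> \<delta> ^ (s + t - 2) / (2 * real s * real t) * k ^ (s * t) * real (card V) ^ s \<and>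
        (\<forall>A B. A \<subseteq> V \<longrightarrow> B \<subseteq> V \<longrightarrow> 1 \<le> card A \<longrightarrow> card A \<le> s \<longrightarrow> 1 \<le> card B \<longrightarrow> card B \<le> t \<longrightarrow>
          real (pair_degree H A B) \<le> max_degree s t \<delta> (card A) (card B) k (card V))"
proof -
  define n where "n = card V"
  \<comment> \<open>The edge number is \<open>n * m\<close>, so the average degree is
    \<open>2 * m\<close>.\<close>
  define m where "m = k * real n powr ((real s - 1) / real s)"
  define q where "q = \<delta> * k ^ s"
  define D where "D i j = max_degree s t \<delta> i j k n" for i j
  have D_eq: "D i j = (\<delta> * m) ^ (s - i) * q ^ (t - j)" for i j
    by (simp add: D_def max_degree_def m_def q_def mult.assoc)
  have finV: "finite V" using graph by (simp add: simple_graph_def)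
  define valid where "valid H \<longleftrightarrow>
    (\<forall>(S, T)\<in>H. S \<subseteq> V \<and> T \<subseteq> V \<and> card S = s \<and> card T = t \<and> complete_between E S T) \<and>
    (\<forall>A B. A \<subseteq> V \<longrightarrow> B \<subseteq> V \<longrightarrow> 1 \<le> card A \<longrightarrow> card A \<le> s \<longrightarrow> 1 \<le> card B \<longrightarrow> card B \<le> t \<longrightarrow>
          real (pair_degree H A B) \<le> D (card A) (card B))" for H
  have kpos: "0 < k" using k \<delta>(1) by (smt (verit) mult_nonneg_nonpos)
  have "0 \<le> m" "0 \<le> q" using kpos \<delta>(1) by (simp_all add: m_def q_def)
  have fin: "finite H" "H \<subseteq> Pow V \<times> Pow V" if "valid H" for H
  proof -
    show "H \<subseteq> Pow V \<times> Pow V" using that by (auto simp: valid_def)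
    then show "finite H" using finV finite_subset by blast
  qed
  have "valid {}" using \<open>0 \<le> m\<close> \<open>0 \<le> q\<close> \<delta>(1) by (auto simp: valid_def pair_degree_def D_eq)
  moreover have "\<forall>H. valid H \<longrightarrow> card H < Suc (card (Pow V \<times> Pow V))"
    using fin card_mono[of "Pow V \<times> Pow V"] finV by (auto simp: less_Suc_eq_le)
  ultimately obtain H where H: "valid H" and maximal: "\<And>H'. valid H' \<Longrightarrow> card H' \<le> card H"
    using ex_has_greatest_nat[of valid "{}" card] by blast
  have "\<delta> ^ (s + t - 2) / (2 * real s * real t) * k ^ (s * t) * real n ^ s \<le> real (card H)"
  proof (rule ccontr)
    assume "\<not> ?thesis"
    then have small: "real (card H) < \<delta> ^ (s + t - 2) / (2 * real s * real t) * k ^ (s * t) * real n ^ s"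
      by simp
    \<comment> \<open>For \<open>n = 0\<close> the assumed upper bound on \<open>card H\<close>
      would be \<open>0\<close>.\<close>
    have "0 < n"
    proof (rule ccontr)
      assume "\<not> 0 < n" then show False using small assms(1) by (simp add: power_0_left)
    qed
    have st: "0 < s" "0 < t" using assms by auto
    have \<delta>_le: "\<delta> \<le> 1"
    proof -
      have "1 \<le> 2 ^ (s + t + 4) * real t * 4 ^ s"
        using st(2) by (intro mult_ge1_I) auto
      then show ?thesis using \<delta> by (smt (verit) mult_left_le mult_le_cancel_left1)
    qed
    have k1: "1 \<le> k" using k \<delta>_le kpos by (smt (verit) mult_left_le_one_le \<delta>(1))
    have km: "k \<le> m"
    proof -
      have "1 \<le> real n powr ((real s - 1) / real s)"
        using \<open>0 < n\<close> st by (intro ge_one_powr_ge_zero) auto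
      then show ?thesis using kpos by (simp add: m_def)
    qed
    have kk: "k \<le> k ^ s" using k1 st self_le_power by blast
    have two: "2 \<le> \<delta> * m" "2 \<le> q"
      using k km kk \<delta>(1) unfolding q_def by (smt (verit) mult_left_mono)+
    have npow: "real n powr (2 - 1 / real s) = real n * real n powr ((real s - 1) / real s)"
    proof -
      have "2 - 1 / real s = 1 + (real s - 1) / real s" using st by (simp add: field_simps)
      then show ?thesis using \<open>0 < n\<close> by (simp only: powr_add) simp
    qed
    have mpow: "m ^ s = k ^ s * real n ^ (s - 1)"
    proof -
      have "(real n powr ((real s - 1) / real s)) ^ s = real n powr ((real s - 1) / real s * real s)"
        using \<open>0 < n\<close> by (simp add: powr_power)
      also have "\<dots> = real n powr (real (s - 1))" using st by (simp add: of_nat_diff)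
      also have "\<dots> = real n ^ (s - 1)" using \<open>0 < n\<close> by (simp add: powr_realpow)
      finally show ?thesis by (simp add: m_def power_mult_distrib)
    qed
    interpret bounded_degree_family s t V H D "\<delta> * m" q
    proof
      fix i j assume ij: "1 \<le> i" "i \<le> s" "1 \<le> j" "j \<le> t"
      show "D i j = 1 \<or> 2 \<le> D i j"
      proof (cases "i = s")
        case True
        show ?thesis
        proof (cases "j = t")
          case False
          then have "q ^ 1 \<le> q ^ (t - j)" using two ij by (intro power_increasing) auto
          then show ?thesis using two True by (simp add: D_eq)
        qed (use True in \<open>simp add: D_eq\<close>)
      next
        case False
        then have "(\<delta> * m) ^ 1 \<le> (\<delta> * m) ^ (s - i)" using two ij by (intro power_increasing) auto
        moreover have "1 \<le> q ^ (t - j)" using two by (intro one_le_power) auto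
        ultimately have "2 * 1 \<le> D i j" unfolding D_eq using two by (intro mult_mono) auto
        then show ?thesis by simp
      qed
    next
      fix i j assume "i < s"
      then have "s - i = Suc (s - Suc i)" by simp
      then show "D i j \<le> \<delta> * m * D (Suc i) j" by (simp add: D_eq)
    next
      fix i j assume "j < t"
      then have "t - j = Suc (t - Suc j)" by simp
      then show "D i j \<le> q * D i (Suc j)" by (simp add: D_eq)
    qed (use finV H two in \<open>auto simp: valid_def\<close>)
    define F where "F = {(x, y). {x, y} \<in> E}"
    define Z where "Z = {(x, y) \<in> V \<times> V. saturated {x} {y}}"
    have FV: "F \<subseteq> V \<times> V" using graph by (auto simp: F_def simple_graph_def nsets_def)
    have "real (card Z) * D 1 1 \<le> 2 * real s * real t * real (card H)"
      unfolding Z_def using st by (intro card_saturated_edges) auto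
    also have "\<dots> < \<delta> ^ (s + t - 2) * k ^ (s * t) * real n ^ s"
      using small st by (simp add: field_simps)
    \<comment> \<open>This identity dictates the constant in the size bound: \<open>D 1 1\<close>
      contributes \<open>s - 1\<close> factors \<open>\<delta>\<close> from the left and
      \<open>t - 1\<close> from the right.\<close>
    also have "\<dots> = (real n * m) * D 1 1"
    proof -
      obtain s' t' where s': "s = Suc s'" and t': "t = Suc t'"
        using st by (auto simp: gr0_conv_Suc)
      have "(real n * m) * D 1 1 = real n * m ^ s * \<delta> ^ s' * q ^ t'"
        by (simp add: D_eq s' t' power_mult_distrib)
      also have "\<dots> = real n ^ s * k ^ s * \<delta> ^ s' * (\<delta> ^ t' * k ^ (s * t'))"
        unfolding mpow q_def by (simp add: s' power_mult_distrib power_add flip: power_mult)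
      also have "\<dots> = \<delta> ^ (s + t - 2) * k ^ (s * t) * real n ^ s"
        by (simp add: s' t' power_add)
      finally show ?thesis by simp
    qed
    finally have Z: "real (card Z) < real n * m"
      using D_pos[of 1 1] st by simp
    \<comment> \<open>Each edge has two orientations, so fewer than half of the
      \<open>2 * n * m\<close> oriented edges are saturated.\<close>
    have "real (card F) = 2 * (real n * m)"
      using card_oriented_edges[OF graph] edges npow by (simp add: F_def m_def flip: n_def)
    moreover have "card F - card Z \<le> card (F - Z)"
      by (rule diff_card_le_card_Diff) (auto simp: Z_def finV intro: finite_subset[of _ "V \<times> V"])
    ultimately have dense: "real n * m \<le> real (card (F - Z))" using Z by linarith
    have "\<exists>S T. S \<subseteq> V \<and> T \<subseteq> V \<and> card S = s \<and> card T = t \<and> S \<times> T \<subseteq> F - Z \<and>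
      (\<forall>A B. A \<subseteq> S \<longrightarrow> A \<noteq> {} \<longrightarrow> B \<subseteq> T \<longrightarrow> B \<noteq> {} \<longrightarrow> \<not> saturated A B)"
    proof (rule exists_unsaturated_pair[of _ m])
      have t_large: "16 * 2 ^ (s + t) * real t * 4 ^ s * 2 \<le> k"
      proof -
        have "\<delta> * (16 * 2 ^ (s + t) * real t * 4 ^ s * 2) \<le> \<delta> * k"
          using \<delta>(2) k by (simp add: power_add)
        then show ?thesis using \<delta>(1) by simp
      qed
      have s_le: "8 * real s \<le> 16 * 2 ^ (s + t) * real t * 4 ^ s * 2"
      proof -
        have "(8 * real s) * 1 \<le> (16 * real t) * (2 ^ (s + t) * 4 ^ s * 2)"
          using assms(2) by (intro mult_mono mult_ge1_I) (auto intro!: mult_ge1_I)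
        then show ?thesis by (simp add: ac_simps)
      qed
      show "8 * real s \<le> m" using s_le t_large km by linarith
      have "8 * (2 ^ s * (2 * real s)) \<le> 2 ^ (s + t + 4) * real t * 4 ^ s"
      proof -
        have "(16 * 2 ^ s * real s) * 1 \<le> (16 * 2 ^ s * real t) * (2 ^ t * 4 ^ s)"
          using assms(2) by (intro mult_mono) (auto intro!: mult_ge1_I)
        then show ?thesis by (simp add: power_add ac_simps)
      qed
      then have "\<delta> * (8 * (2 ^ s * (2 * real s))) \<le> 1"
        using \<delta> by (meson mult_left_mono less_imp_le order_trans)
      then have "\<delta> * (8 * (2 ^ s * (2 * real s))) * m \<le> 1 * m"
        using \<open>0 \<le> m\<close> by (rule mult_right_mono)
      then show "8 * (2 ^ s * (2 * real s * (\<delta> * m))) \<le> m" by (simp add: ac_simps)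
      \<comment> \<open>The first term is at most a quarter of the right-hand side because
        \<open>k\<close> is large, the second at most an eighth because \<open>\<delta>\<close> is
        small.\<close>
      have "real t + 2 ^ (s + t) * (2 * real t * q) < (k / 4) ^ s"
      proof -
        have "(4 ^ s * real t * 4) * 1 \<le> (4 ^ s * real t * 32) * 2 ^ (s + t)"
          by (intro mult_mono) auto
        also have "\<dots> \<le> k ^ s" using t_large kk by (simp add: ac_simps)
        finally have "4 ^ s * real t * 4 \<le> k ^ s" by simp
        then have "real t \<le> (k / 4) ^ s / 4" by (simp add: power_divide field_simps)
        moreover have "(\<delta> * (2 ^ (s + t + 4) * real t * 4 ^ s)) * k ^ s \<le> 1 * k ^ s"
          using \<delta>(2) kpos by (intro mult_right_mono) auto
        then have "2 ^ (s + t) * (2 * real t * q) \<le> (k / 4) ^ s / 8"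
          by (simp add: q_def power_divide power_add field_simps)
        moreover have "0 < (k / 4) ^ s" using kpos by simp
        ultimately show ?thesis by linarith
      qed
      then have "real n ^ s * (real t + 2 ^ (s + t) * (2 * real t * q)) < real n ^ s * (k / 4) ^ s"
        using \<open>0 < n\<close> by simp
      \<comment> \<open>Here the exponent in \<open>m\<close> pays off:
        \<open>n * m ^ s = k ^ s * n ^ s\<close>.\<close>
      also have "\<dots> = real n * (m / 4) ^ s"
        unfolding power_divide mpow using st by (cases s) simp_all
      finally show "real (card V) ^ s * (real t + 2 ^ (s + t) * (2 * real t * q)) < real (card V) * (m / 4) ^ s"
        by (simp add: n_def)
    qed (use FV st \<open>0 \<le> m\<close> dense in \<open>auto simp: Z_def n_def\<close>)
    then obtain S T where ST: "S \<subseteq> V" "T \<subseteq> V" "card S = s" "card T = t" "S \<times> T \<subseteq> F"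
      and unsat: "\<And>A B. \<lbrakk>A \<subseteq> S; A \<noteq> {}; B \<subseteq> T; B \<noteq> {}\<rbrakk> \<Longrightarrow> \<not> saturated A B"
      by (elim exE conjE) (metis Diff_subset subset_trans)
    have "(S, T) \<notin> H"
    proof
      assume mem: "(S, T) \<in> H"
      have "finite {(S', T'). (S', T') \<in> H \<and> S \<subseteq> S' \<and> T \<subseteq> T'}"
        by (rule finite_subset[OF _ finite_H]) auto
      then have "0 < pair_degree H S T"
        using mem unfolding pair_degree_def by (auto simp: card_gt_0_iff)
      \<comment> \<open>Both exponents vanish, so \<open>D s t = 1\<close> and any member of
        \<open>H\<close> is already saturated.\<close>
      then have "saturated S T" using ST by (simp add: saturated_def D_eq)
      moreover have "S \<noteq> {}" "T \<noteq> {}" using ST st by auto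
      ultimately show False using unsat by blast
    qed
    moreover have "valid (insert (S, T) H)"
      unfolding valid_def
    proof (intro conjI allI impI)
      show "\<forall>(S, T)\<in>insert (S, T) H. S \<subseteq> V \<and> T \<subseteq> V \<and> card S = s \<and> card T = t \<and> complete_between E S T"
        using H ST by (auto simp: valid_def complete_between_def F_def)
      fix A B assume AB: "A \<subseteq> V" "B \<subseteq> V" "1 \<le> card A" "card A \<le> s" "1 \<le> card B" "card B \<le> t"
      let ?K = "{(S, T). (S, T) \<in> H \<and> A \<subseteq> S \<and> B \<subseteq> T}"
      show "real (pair_degree (insert (S, T) H) A B) \<le> D (card A) (card B)"
      \<comment> \<open>Only pairs below \<open>(S, T)\<close> gain degree, by at most one, and
        being unsaturated they have room for it.\<close>
      proof (cases "A \<subseteq> S \<and> B \<subseteq> T")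
        case True
        have "A \<noteq> {}" "B \<noteq> {}" using AB by auto
        then have "\<not> saturated A B" using unsat True by blast
        moreover have "{(S', T'). (S', T') \<in> insert (S, T) H \<and> A \<subseteq> S' \<and> B \<subseteq> T'} = insert (S, T) ?K"
          using True by auto
        then have "pair_degree (insert (S, T) H) A B \<le> Suc (pair_degree H A B)"
          using finite_H by (simp add: pair_degree_def card_insert_le_m1)
        ultimately show ?thesis by (simp add: saturated_def)
      next
        case False
        then have "{(S', T'). (S', T') \<in> insert (S, T) H \<and> A \<subseteq> S' \<and> B \<subseteq> T'} = ?K" by auto
        then show ?thesis using degree_le[OF AB] by (simp add: pair_degree_def)
      qed
    qed
    ultimately show False using maximal[of "insert (S, T) H"] finite_H by simp
  qed
  then show ?thesis using H unfolding valid_def D_def n_def by blast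
qed

theorem theorem7p4:
  fixes s t :: nat
  assumes "2 \<le> s" and "s \<le> t"
  shows "\<exists>(C::real) (\<delta>::real) (k\<^sub>0::nat) (c::real). C > 0 \<and> \<delta> > 0 \<and> c > 0 \<and>
    (\<forall>(k::real) (n::nat) (V::'a set) (E::'a set set).
      k \<ge> real k\<^sub>0 \<longrightarrow> simple_graph V E \<longrightarrow> card V = n \<longrightarrow>
      real (card E) = k * real n powr (2 - 1 / real s) \<longrightarrow>
      (\<exists>H :: ('a set \<times> 'a set) set.
        (\<forall>(S, T)\<in>H. S \<subseteq> V \<and> T \<subseteq> V \<and> card S = s \<and> card T = t \<and> complete_between E S T) \<and>
        real (card H) \<ge> c * k ^ (s * t) * real n ^ s \<and>
        (\<forall>A B. A \<subseteq> V \<longrightarrow> B \<subseteq> V \<longrightarrow> 1 \<le> card A \<longrightarrow> card A \<le> s \<longrightarrow> 1 \<le> card B \<longrightarrow> card B \<le> t \<longrightarrow>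
          real (pair_degree H A B) \<le> max_degree s t \<delta> (card A) (card B) k n)))"
proof -
  \<comment> \<open>\<open>\<delta>\<close> is the reciprocal of a natural number \<open>M\<close>,
    so the natural threshold \<open>2 * M\<close> for \<open>k\<close> yields
    \<open>2 \<le> \<delta> * k\<close>.\<close>
  define M where "M = 2 ^ (s + t + 4) * t * 4 ^ s"
  define \<delta> where "\<delta> = 1 / real M"
  have M: "0 < M" using assms by (simp add: M_def)
  then have \<delta>: "0 < \<delta>" "\<delta> * (2 ^ (s + t + 4) * real t * 4 ^ s) \<le> 1"
    by (auto simp: \<delta>_def M_def)
  have k: "2 \<le> \<delta> * k" if "real (2 * M) \<le> k" for k :: real
    using that M by (simp add: \<delta>_def field_simps)
  have "0 < \<delta> ^ (s + t - 2) / (2 * real s * real t)" using \<delta> assms by simp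
  moreover have "\<exists>H :: ('a set \<times> 'a set) set.
        (\<forall>(S, T)\<in>H. S \<subseteq> V \<and> T \<subseteq> V \<and> card S = s \<and> card T = t \<and> complete_between E S T) \<and>
        real (card H) \<ge> \<delta> ^ (s + t - 2) / (2 * real s * real t) * k ^ (s * t) * real n ^ s \<and>
        (\<forall>A B. A \<subseteq> V \<longrightarrow> B \<subseteq> V \<longrightarrow> 1 \<le> card A \<longrightarrow> card A \<le> s \<longrightarrow> 1 \<le> card B \<longrightarrow> card B \<le> t \<longrightarrow>
          real (pair_degree H A B) \<le> max_degree s t \<delta> (card A) (card B) k n)"
    if "real (2 * M) \<le> k" "simple_graph V E" "card V = n"
      "real (card E) = k * real n powr (2 - 1 / real s)"
    for k :: real and n :: nat and V :: "'a set" and E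
    using balanced_family_exists[OF assms that(2) _ \<delta> k[OF that(1)]] that(3,4) by simp
  ultimately show ?thesis
    using \<delta>(1) by - (rule exI[of _ 1], rule exI[of _ \<delta>], rule exI[of _ "2 * M"],
      rule exI[of _ "\<delta> ^ (s + t - 2) / (2 * real s * real t)"],
      intro conjI allI impI zero_less_one; assumption?; simp only:)
qed

end
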